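(* Let $G=\langle V\cup\{s\},E\rangle$ be a weighted undirected graph with source $s$ and edge costs $c_{(i,j)}\ge 0$. The average marginal cost mechanism (AMCM) $(g,f,x)$ satisfies positiveness: for every report profile $\theta'\in\Theta$ and every $i\in V$, $x_i(\theta')\ge 0$.
   Context: Setting. $G=\langle V\cup\{s\},E\rangle$ is a finite weighted undirected graph; $s$ is the source, and each edge $(i,j)\in E$ has cost $c_{(i,j)}\ge 0$. For $i\in V\cup\{s\}$, $\Theta_i$ is the set of all sets of edges of $E$ adjacent to $i$, and $\Theta=\prod_{i\in V\cup\{s\}}\Theta_i$. A report profile $\theta'\in\Theta$ induces the graph $G_{\theta'}=\langle V\cup\{s\},E_{\theta'}\rangle$ with $E_{\theta'}=\{(i,j)\in E : (i,j)\in\theta_i'\cap\theta_j'\}$. A cost sharing mechanism $(g,f,x)$ assigns to each $\theta'\in\Theta$ a set $g(\theta')\subseteq V$ of selected (connected) nodes, a set $f(\theta')\subseteq E_{\theta'}$ of selected edges connecting the nodes of $g(\theta')$ (to the source), and cost shares $x_i(\theta')\in\mathbb{R}$ for $i\in V$, with $x_i(\theta')=0$ if $i\notin g(\theta')$. AMCM. Given $\theta'\in\Theta$: compute, by Prim's algorithm started at $s$, a minimum spanning tree (of the connected component of $s$) in $G_{\theta'}$. Let $g(\theta')$ be the set of nodes other than $s$ in this tree (i.e. the nodes of $V$ connected to $s$ in $G_{\theta'}$) and $f(\theta')$ its edge set. For $S\subseteq g(\theta')$ let $v(S)$ be the minimum cost to connect $S$ to $s$ in $G_{\theta'}$, i.e.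 the minimum total edge cost of a connected subgraph of $G_{\theta'}$ containing $S\cup\{s\}$ (nodes outside $S$ may be used as intermediate nodes; $v(\emptyset)=0$). For $i\in g(\theta')$ set $$x_i(\theta')=\sum_{S\subseteq g(\theta')\setminus\{i\}}\frac{|S|!\,(|g(\theta')|-|S|-1)!}{|g(\theta')|!}\,\bigl(v(S\cup\{i\})-v(S)\bigr),$$ and $x_i(\theta')=0$ for $i\in V\setminus g(\theta')$. *)

theory Defs
  imports Complex_Main "HOL-Library.FuncSet"
begin

text \<open>An undirected edge \<open>(i,j)\<close> is the set \<open>{i, j}\<close>. Loops are not excluded; they occur in no
  spanning tree. Costs matter on \<open>E\<close> only.\<close>

definition source_graph :: "'a set \<Rightarrow> 'a \<Rightarrow> 'a set set \<Rightarrow> ('a set \<Rightarrow> real) \<Rightarrow> bool" where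
  "source_graph V s E c \<longleftrightarrow>
     finite V \<and> s \<notin> V \<and>
     E \<subseteq> {{i, j} | i j. i \<in> V \<union> {s} \<and> j \<in> V \<union> {s}} \<and>
     (\<forall>e\<in>E. c e \<ge> 0)"

type_synonym 'a profile = "'a \<Rightarrow> 'a set set"

definition report_space :: "'a set set \<Rightarrow> 'a \<Rightarrow> 'a set set set" where
  "report_space E i = Pow {e \<in> E. i \<in> e}"

definition profiles :: "'a set \<Rightarrow> 'a \<Rightarrow> 'a set set \<Rightarrow> 'a profile set" where
  "profiles V s E = (\<Pi>\<^sub>E i \<in> V \<union> {s}. report_space E i)"

definition induced_edges :: "'a set set \<Rightarrow> 'a profile \<Rightarrow> 'a set set" where
  "induced_edges E \<theta> = {{i, j} | i j. {i, j} \<in> E \<and> {i, j} \<in> \<theta> i \<inter> \<theta> j}"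

text \<open>The states \<open>(U, T)\<close> (visited nodes, tree edges) that Prim's algorithm started at \<open>s\<close> can
  reach on a graph with edge set \<open>F\<close>. Ties between cheapest crossing edges are broken arbitrarily.\<close>

inductive prim_reaches ::
  "'a set set \<Rightarrow> ('a set \<Rightarrow> real) \<Rightarrow> 'a \<Rightarrow> 'a set \<Rightarrow> 'a set set \<Rightarrow> bool"
  for F c s where
  start: "prim_reaches F c s {s} {}"
| step: "prim_reaches F c s (insert w U) (insert {u, w} T)"
  if "prim_reaches F c s U T"
    and "u \<in> U" and "w \<notin> U" and "{u, w} \<in> F"
    and "\<And>a b. a \<in> U \<Longrightarrow> b \<notin> U \<Longrightarrow> {a, b} \<in> F \<Longrightarrow> c {u, w} \<le> c {a, b}"

definition prim_output ::
  "'a set set \<Rightarrow> ('a set \<Rightarrow> real) \<Rightarrow> 'a \<Rightarrow> 'a set \<Rightarrow> 'a set set \<Rightarrow> bool" where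
  "prim_output F c s U T \<longleftrightarrow>
     prim_reaches F c s U T \<and> \<not> (\<exists>a b. a \<in> U \<and> b \<notin> U \<and> {a, b} \<in> F)"

definition connected_graph :: "'a set \<Rightarrow> 'a set set \<Rightarrow> bool" where
  "connected_graph W H \<longleftrightarrow> (\<forall>u\<in>W. \<forall>w\<in>W. (u, w) \<in> {(a, b). {a, b} \<in> H}\<^sup>*)"

text \<open>The minimum cost \<open>v(S)\<close> of connecting \<open>S\<close> to \<open>s\<close> in the graph with nodes \<open>N\<close> and edges
  \<open>F\<close>, over connected subgraphs \<open>(W, H)\<close>. It is meaningful only if some such subgraph exists,
  as is the case when all nodes of \<open>S\<close> are connected to \<open>s\<close>.\<close>

definition connection_cost ::
  "'a set \<Rightarrow> 'a set set \<Rightarrow> ('a set \<Rightarrow> real) \<Rightarrow> 'a \<Rightarrow> 'a set \<Rightarrow> real" where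
  "connection_cost N F c s S =
     Min {(\<Sum>e\<in>H. c e) | W H.
            W \<subseteq> N \<and> H \<subseteq> F \<and> (\<forall>e\<in>H. e \<subseteq> W) \<and> connected_graph W H \<and> S \<union> {s} \<subseteq> W}"

definition average_marginal_cost :: "'a set \<Rightarrow> ('a set \<Rightarrow> real) \<Rightarrow> 'a \<Rightarrow> real" where
  "average_marginal_cost A v i =
     (\<Sum>S \<in> Pow (A - {i}).
        fact (card S) * fact (card A - card S - 1) / fact (card A) * (v (S \<union> {i}) - v S))"

type_synonym 'a mechanism =
  "('a profile \<Rightarrow> 'a set) \<times> ('a profile \<Rightarrow> 'a set set) \<times> ('a profile \<Rightarrow> 'a \<Rightarrow> real)"

text \<open>A predicate rather than a function, since the minimum spanning tree depends on how Prim's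
  algorithm breaks ties.\<close>

definition is_AMCM ::
  "'a set \<Rightarrow> 'a \<Rightarrow> 'a set set \<Rightarrow> ('a set \<Rightarrow> real) \<Rightarrow> 'a mechanism \<Rightarrow> bool" where
  "is_AMCM V s E c = (\<lambda>(g, f, x). \<forall>\<theta> \<in> profiles V s E.
     (\<exists>U. prim_output (induced_edges E \<theta>) c s U (f \<theta>) \<and> g \<theta> = U - {s}) \<and>
     (\<forall>i\<in>V. x \<theta> i =
        (if i \<in> g \<theta>
         then average_marginal_cost (g \<theta>)
                (connection_cost (V \<union> {s}) (induced_edges E \<theta>) c s) i
         else 0)))"

definition positiveness :: "'a set \<Rightarrow> 'a \<Rightarrow> 'a set set \<Rightarrow> 'a mechanism \<Rightarrow> bool" where
  "positiveness V s E = (\<lambda>(g, f, x). \<forall>\<theta> \<in> profiles V s E. \<forall>i\<in>V. x \<theta> i \<ge> 0)"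

lemma prim_output_exists:
  assumes "finite N" "\<Union>F \<subseteq> N" "s \<in> N"
  shows "\<exists>U T. prim_output F c s U T"
proof -
  have "\<exists>U T. prim_output F c s U T" if "prim_reaches F c s U T" for U T
    using that
  proof (induction "card (N - U)" arbitrary: U T rule: less_induct)
    case less
    show ?case
    proof (cases "\<exists>a b. a \<in> U \<and> b \<notin> U \<and> {a, b} \<in> F")
      case False
      with less.prems show ?thesis unfolding prim_output_def by blast
    next
      case True
      define C where "C = {e \<in> F. \<exists>a b. a \<in> U \<and> b \<notin> U \<and> e = {a, b}}"
      have "finite F" using assms(1,2) by (simp add: finite_UnionD finite_subset)
      then have "finite C" "C \<noteq> {}" using True by (auto simp: C_def)
      then obtain e where e: "e \<in> C" "\<And>d. d \<in> C \<Longrightarrow> c e \<le> c d"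
        using arg_min_if_finite[of C c] by (meson not_less)
      then obtain u w where uw: "u \<in> U" "w \<notin> U" "{u, w} \<in> F" "e = {u, w}"
        by (auto simp: C_def)
      have "c {u, w} \<le> c {a, b}" if "a \<in> U" "b \<notin> U" "{a, b} \<in> F" for a b
        using e(2)[of "{a, b}"] that uw(4) by (auto simp: C_def)
      then have r: "prim_reaches F c s (insert w U) (insert {u, w} T)"
        using prim_reaches.step[OF less.prems] uw by blast
      have "w \<in> N" using uw(3) assms(2) by auto
      then have "card (N - insert w U) < card (N - U)"
        using uw(2) assms(1) by (intro psubset_card_mono) auto
      from less.hyps[OF this r] show ?thesis .
    qed
  qed
  from this[OF prim_reaches.start] show ?thesis .
qed

lemma AMCM_exists:
  assumes "source_graph V s E c"
  shows "\<exists>M. is_AMCM V s E c M"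
proof -
  have "finite (V \<union> {s})" "\<Union>E \<subseteq> V \<union> {s}"
    using assms unfolding source_graph_def by fastforce+
  moreover have "induced_edges E \<theta> \<subseteq> E" for \<theta>
    by (auto simp: induced_edges_def)
  ultimately have "\<exists>U T. prim_output (induced_edges E \<theta>) c s U T" for \<theta>
    using prim_output_exists[of "V \<union> {s}" "induced_edges E \<theta>" s c] by blast
  then obtain u t where "prim_output (induced_edges E \<theta>) c s (u \<theta>) (t \<theta>)" for \<theta> by metis
  then have "is_AMCM V s E c (\<lambda>\<theta>. u \<theta> - {s}, t, \<lambda>\<theta> i. if i \<in> u \<theta> - {s}
     then average_marginal_cost (u \<theta> - {s})
            (connection_cost (V \<union> {s}) (induced_edges E \<theta>) c s) i else 0)"
    unfolding is_AMCM_def by auto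
  then show ?thesis ..
qed

end

theory Submission
  imports Defs
begin

text \<open>A connected subgraph reaching \<open>S'\<close> also reaches every \<open>S \<subseteq> S'\<close>, so the connection cost is
  monotone and every marginal cost is nonnegative. The tree found by Prim's algorithm witnesses
  that the minimum is over a nonempty set for all sets of selected nodes.\<close>

text \<open>Any two nodes are joined by a walk through \<open>u\<close>: old nodes reach it by
  connectedness of \<open>W\<close>, and \<open>w\<close> by the new edge. This is one growth step
  of Prim's algorithm.\<close>

lemma connected_graph_insert:
  assumes "connected_graph W H" "u \<in> W"
  shows "connected_graph (insert w W) (insert {u, w} H)"
proof -
  let ?R = "{(a, b). {a, b} \<in> insert {u, w} H}"
  have "{(a, b). {a, b} \<in> H}\<^sup>* \<subseteq> ?R\<^sup>*"
    by (intro rtrancl_mono) auto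
  then have old: "(a, b) \<in> ?R\<^sup>*" if "a \<in> W" "b \<in> W" for a b
    using assms(1) that unfolding connected_graph_def by (meson subsetD)
  have new: "(u, w) \<in> ?R\<^sup>*" "(w, u) \<in> ?R\<^sup>*"
    by (rule r_into_rtrancl, simp add: insert_commute)+
  have "(a, b) \<in> ?R\<^sup>*" if "a \<in> insert w W" "b \<in> insert w W" for a b
  proof -
    have "(a, u) \<in> ?R\<^sup>*" "(u, b) \<in> ?R\<^sup>*"
      using that old[OF _ assms(2)] old[OF assms(2)] new by (metis insertE)+
    then show ?thesis by (rule rtrancl_trans)
  qed
  then show ?thesis unfolding connected_graph_def by (intro ballI)
qed

text \<open>Invariant of every run, by induction on its steps. The bound on \<open>U\<close> later
  places the tree inside the node set; \<open>s\<close> is listed apart from the edge endpoints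
  because it may be isolated.\<close>

lemma prim_reaches_connected_subgraph:
  assumes "prim_reaches F c s U T"
  shows "s \<in> U \<and> U \<subseteq> insert s (\<Union>F) \<and> T \<subseteq> F \<and> (\<forall>e\<in>T. e \<subseteq> U) \<and> connected_graph U T"
  using assms
proof induction
  case start
  show ?case by (simp add: connected_graph_def)
next
  case (step U T u w)
  then show ?case using connected_graph_insert[of U T u w] by auto
qed

text \<open>\<open>Min\<close> only behaves well on finite nonempty sets: \<open>finite F\<close>
  provides the former, and \<open>(W, H)\<close> is a feasible subgraph for the larger set
  \<open>S'\<close> that provides the latter.\<close>

lemma connection_cost_mono:
  assumes "finite F" "S \<subseteq> S'"
    and "W \<subseteq> N" "H \<subseteq> F" "\<forall>e\<in>H. e \<subseteq> W" "connected_graph W H" "S' \<union> {s} \<subseteq> W"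
  shows "connection_cost N F c s S \<le> connection_cost N F c s S'"
proof -
  define costs where "costs S = {(\<Sum>e\<in>H. c e) | W H.
    W \<subseteq> N \<and> H \<subseteq> F \<and> (\<forall>e\<in>H. e \<subseteq> W) \<and> connected_graph W H \<and> S \<union> {s} \<subseteq> W}" for S
  \<comment> \<open>A cost depends on \<open>H\<close> alone, so finitely many values occur whatever
    the node sets \<open>W\<close> are.\<close>
  have "costs S \<subseteq> sum c ` Pow F"
    unfolding costs_def by auto
  then have "finite (costs S)"
    using assms(1) finite_subset by blast
  moreover have "costs S' \<noteq> {}"
    using assms(3-) unfolding costs_def by blast
  moreover have "costs S' \<subseteq> costs S"
    unfolding costs_def using assms(2)
    by (intro Collect_mono impI; elim exE conjE)
      (intro exI conjI, assumption+, meson Un_mono order_refl order_trans)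
  ultimately have "Min (costs S) \<le> Min (costs S')"
    by (intro Min_antimono)
  then show ?thesis unfolding connection_cost_def costs_def .
qed

text \<open>The weights are quotients of factorials, hence nonnegative, so the sum inherits the sign
  of the marginal costs.\<close>

lemma average_marginal_cost_nonneg:
  assumes "\<And>S. S \<subseteq> A - {i} \<Longrightarrow> v S \<le> v (S \<union> {i})"
  shows "average_marginal_cost A v i \<ge> 0"
  unfolding average_marginal_cost_def
  by (intro sum_nonneg mult_nonneg_nonneg divide_nonneg_nonneg fact_ge_zero)
    (use assms in simp)

theorem theorem4p5:
  fixes V :: "'a set" and s :: 'a and E :: "'a set set" and c :: "'a set \<Rightarrow> real"
    and g :: "'a profile \<Rightarrow> 'a set" and f :: "'a profile \<Rightarrow> 'a set set"
    and x :: "'a profile \<Rightarrow> 'a \<Rightarrow> real"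
  assumes "source_graph V s E c"
    and "is_AMCM V s E c (g, f, x)"
  shows "positiveness V s E (g, f, x)"
proof -
  have "x \<theta> i \<ge> 0" if \<theta>: "\<theta> \<in> profiles V s E" and i: "i \<in> V" for \<theta> i
  proof -
    let ?N = "V \<union> {s}" and ?F = "induced_edges E \<theta>"
    have "?F \<subseteq> E"
      by (auto simp: induced_edges_def)
    moreover have "\<Union>E \<subseteq> ?N" "finite ?N"
      using assms(1) unfolding source_graph_def by fastforce+
    ultimately have F: "\<Union>?F \<subseteq> ?N" and "finite (\<Union>?F)"
      by (blast, meson Union_mono finite_subset order_trans)
    then have fin: "finite ?F"
      by (simp add: finite_UnionD)
    obtain U where U: "prim_reaches ?F c s U (f \<theta>)" "g \<theta> = U - {s}"
      using assms(2) \<theta> unfolding is_AMCM_def prim_output_def by auto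
    note sub = prim_reaches_connected_subgraph[OF U(1)]
    have UN: "U \<subseteq> ?N"
      using sub F by blast
    show ?thesis
    proof (cases "i \<in> g \<theta>")
      case True
      have "connection_cost ?N ?F c s S \<le> connection_cost ?N ?F c s (S \<union> {i})"
        if "S \<subseteq> g \<theta> - {i}" for S
        \<comment> \<open>One tree serves for all \<open>S\<close> at once: it spans
          \<open>U\<close>, which contains \<open>s\<close> and all of \<open>g \<theta>\<close>,
          hence also \<open>S \<union> {i}\<close>.\<close>
        by (rule connection_cost_mono[where W = U and H = "f \<theta>"])
          (use fin sub UN that True U(2) in \<open>blast+\<close>)
      then have "average_marginal_cost (g \<theta>) (connection_cost ?N ?F c s) i \<ge> 0"
        by (rule average_marginal_cost_nonneg)
      moreover have "x \<theta> i = average_marginal_cost (g \<theta>) (connection_cost ?N ?F c s) i"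
        using assms(2) \<theta> i True unfolding is_AMCM_def by simp
      ultimately show ?thesis by simp
    next
      case False
      then show ?thesis using assms(2) \<theta> i unfolding is_AMCM_def by simp
    qed
  qed
  then show ?thesis unfolding positiveness_def by auto
qed

end
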